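(* Let $H$ be a real Hilbert space, let $K\subset H$ be a non-empty closed convex set and let $F\colon K\to H$ be strongly pseudomonotone on $K$ with modulus $\gamma>0$. Suppose that the variational inequality $\mathrm{VI}(K,F)$ is solvable and that its unique solution is $x^\ast$. Let $\{\lambda_k\}_{k\ge1}$ be a sequence of positive real numbers with $\sum_{k=1}^\infty\lambda_k=\infty$ and $\lim_{k\to\infty}\lambda_k=0$, let $x_1\in K$, and let $x_{k+1}=\mathrm{Pr}_K(x_k-\lambda_kF(x_k))$ for all $k\ge1$. Then: (i) for all $k\ge 1$, $$\|x^\ast-x_{k+1}\|^2\le(1-2\lambda_k\gamma)\|x^\ast-x_k\|^2+\lambda_k^2\|F(x_k)\|^2;$$ (ii) if in addition $F$ is bounded on $K$, then $\{x_k\}$ converges in norm to $x^\ast$.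
   Context: $H$ carries the inner product $\langle\cdot,\cdot\rangle$ and the induced norm $\|\cdot\|$. $\mathrm{VI}(K,F)$ is the problem of finding $x^\ast\in K$ such that $\langle F(x^\ast),x-x^\ast\rangle\ge 0$ for all $x\in K$; such an $x^\ast$ is called a solution, and $\mathrm{VI}(K,F)$ is solvable if it has a solution. $F$ is strongly pseudomonotone on $K$ with modulus $\gamma>0$ if for all $x,y\in K$: $\langle F(y),x-y\rangle\ge 0$ implies $\langle F(x),x-y\rangle\ge\gamma\|x-y\|^2$. $F$ is bounded on $K$ if there is $M>0$ with $\|F(x)\|\le M$ for all $x\in K$. $\mathrm{Pr}_K(x)$ denotes the metric projection of $x\in H$ onto $K$, i.e. the unique point of $K$ nearest to $x$. No continuity of $F$ is assumed. *)

theory Defs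
  imports "HOL-Analysis.Analysis"
begin

(* A map F : K -> H is a total function on the type of H; every notion below looks only at
   its values on K. *)

definition vi_solution :: "'a::real_inner set \<Rightarrow> ('a \<Rightarrow> 'a) \<Rightarrow> 'a \<Rightarrow> bool" where
  "vi_solution K F z \<longleftrightarrow> z \<in> K \<and> (\<forall>x\<in>K. inner (F z) (x - z) \<ge> 0)"

definition strongly_pseudomonotone_on ::
    "'a::real_inner set \<Rightarrow> ('a \<Rightarrow> 'a) \<Rightarrow> real \<Rightarrow> bool" where
  "strongly_pseudomonotone_on K F \<gamma> \<longleftrightarrow>
     (\<forall>x\<in>K. \<forall>y\<in>K. inner (F y) (x - y) \<ge> 0 \<longrightarrow> inner (F x) (x - y) \<ge> \<gamma> * (norm (x - y))\<^sup>2)"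

(* The library's closest_point is restricted to heine_borel types, hence to finite-dimensional
   spaces. The description below denotes an actual point whenever the nearest point exists
   uniquely, in particular for K non-empty, closed and convex in a Hilbert space. *)
definition metric_projection :: "'a::metric_space set \<Rightarrow> 'a \<Rightarrow> 'a" where
  "metric_projection K x = (THE p. p \<in> K \<and> (\<forall>q\<in>K. dist x p \<le> dist x q))"

(* A solution is automatically the only one, so "the unique solution" needs no separate
   uniqueness hypothesis. *)
lemma vi_solution_unique:
  assumes "strongly_pseudomonotone_on K F \<gamma>" "\<gamma> > 0" "vi_solution K F y" "vi_solution K F z"
  shows "y = z"
proof -
  have "inner (F z) (y - z) \<ge> 0" and yK: "y \<in> K" and zK: "z \<in> K"
    and *: "inner (F y) (z - y) \<ge> 0"
    using assms(3,4) by (auto simp: vi_solution_def)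
  then have "inner (F y) (y - z) \<ge> \<gamma> * (norm (y - z))\<^sup>2"
    using assms(1) by (auto simp: strongly_pseudomonotone_on_def)
  moreover have "inner (F y) (y - z) \<le> 0"
    using * by (simp add: inner_diff_right)
  ultimately have "\<gamma> * (norm (y - z))\<^sup>2 \<le> 0" by linarith
  then show ?thesis
    using assms(2) by (simp add: mult_le_0_iff)
qed

end

theory Submission
  imports Defs
begin

text \<open>The projection is nonexpansive towards points of K, so expanding
  \<open>\<parallel>x\<^sup>* - (x\<^sub>k - \<lambda>\<^sub>k F x\<^sub>k)\<parallel>\<^sup>2\<close> and using strong pseudomonotonicity at the pair
  \<open>(x\<^sub>k, x\<^sup>*)\<close> gives (i). For (ii), (i) has the form
  \<open>a\<^sub>k\<^sub>+\<^sub>1 \<le> (1 - c \<lambda>\<^sub>k) a\<^sub>k + \<lambda>\<^sub>k b\<^sub>k\<close> with \<open>b\<^sub>k \<rightarrow> 0\<close>: eventually the set \<open>a \<le> \<epsilon>\<close> is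
  absorbing, and it is reached because as long as \<open>a\<^sub>k > \<epsilon>\<close> each step decreases \<open>a\<close> by
  at least \<open>c \<epsilon> \<lambda>\<^sub>k / 2\<close>, whose sum diverges.\<close>

text \<open>The parallelogram law for \<open>z - y\<close> and \<open>z - w\<close>, solved for the
  distance of \<open>y\<close> and \<open>w\<close>: if both are nearly nearest to \<open>z\<close>
  and their midpoint is no nearer than the infimum, they must lie close together.\<close>

lemma parallelogram_distance:
  fixes z y w :: "'a::real_inner"
  shows "(dist y w)\<^sup>2 = 2 * (dist z y)\<^sup>2 + 2 * (dist z w)\<^sup>2 - 4 * (dist z (midpoint y w))\<^sup>2"
proof -
  have "z - midpoint y w = (1/2) *\<^sub>R ((z - y) + (z - w))"
    by (simp add: midpoint_def algebra_simps flip: scaleR_add_left)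
  then have "4 * (norm (z - midpoint y w))\<^sup>2 = (norm ((z - y) + (z - w)))\<^sup>2"
    by (simp only: norm_scaleR power_mult_distrib) (simp add: power2_eq_square)
  moreover have "(norm (y - w))\<^sup>2 = (norm ((z - w) - (z - y)))\<^sup>2" by simp
  ultimately show ?thesis
    unfolding dist_norm power2_norm_eq_inner by (simp add: inner_diff inner_add inner_commute)
qed

text \<open>Completeness replaces compactness here. The sets \<open>S n\<close> of near-minimisers
  are closed, nonempty and nested, and convexity makes their diameters shrink to 0, so Cantor's
  intersection theorem gives a common point, whose distance to \<open>z\<close> is the infimum
  \<open>d\<close>.\<close>

lemma nearest_point_exists:
  fixes K :: "'a::{real_inner, complete_space} set"
  assumes "K \<noteq> {}" "closed K" "convex K"
  obtains p where "p \<in> K" "\<And>q. q \<in> K \<Longrightarrow> dist z p \<le> dist z q"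
proof -
  define d where "d = infdist z K"
  define S where "S n = K \<inter> cball z (d + inverse (real (Suc n)))" for n
  have d0: "d \<ge> 0" by (simp add: d_def infdist_nonneg)
  have dle: "d \<le> dist z q" if "q \<in> K" for q
    using that by (simp add: d_def infdist_le)
  have ne: "S n \<noteq> {}" for n
  proof -
    have "infdist z K < d + inverse (real (Suc n))" by (simp add: d_def)
    then obtain q where "q \<in> K" "dist z q < d + inverse (real (Suc n))"
      using assms(1) by (auto simp: infdist_notempty cINF_less_iff)
    then show ?thesis by (auto simp: S_def)
  qed
  have "\<exists>a. \<forall>n. a \<in> S n"
  proof (rule decreasing_closed_nest)
    show "closed (S n)" for n using assms by (simp add: S_def closed_Int)
    show "S n \<noteq> {}" for n by (rule ne)
    show "S n \<subseteq> S m" if "m \<le> n" for m n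
    proof -
      have "inverse (real (Suc n)) \<le> inverse (real (Suc m))" using that by (simp add: field_simps)
      then show ?thesis unfolding S_def by (intro Int_mono subset_refl subset_cball add_left_mono)
    qed
    show "\<exists>n. \<forall>x\<in>S n. \<forall>y\<in>S n. dist x y < e" if "e > 0" for e
    proof -
      \<comment> \<open>This expression bounds the squared distance of any two points of
        \<open>S n\<close>: each is within \<open>d + inverse (real (Suc n))\<close> of
        \<open>z\<close>, while their midpoint stays in \<open>K\<close> and so is at distance at
        least \<open>d\<close>.\<close>
      have "(\<lambda>n. 4 * (d + inverse (real (Suc n)))\<^sup>2 - 4 * d\<^sup>2) \<longlonglongrightarrow> 4 * (d + 0)\<^sup>2 - 4 * d\<^sup>2"
        by (intro tendsto_intros LIMSEQ_inverse_real_of_nat)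
      then have "\<forall>\<^sub>F n in sequentially. 4 * (d + inverse (real (Suc n)))\<^sup>2 - 4 * d\<^sup>2 < e\<^sup>2"
        using that by (intro order_tendstoD) auto
      then obtain n where n: "4 * (d + inverse (real (Suc n)))\<^sup>2 - 4 * d\<^sup>2 < e\<^sup>2"
        using eventually_happens'[OF sequentially_bot] by blast
      have "dist y w < e" if yw: "y \<in> S n" "w \<in> S n" for y w
      proof -
        have "midpoint y w \<in> K"
          using yw assms(3) by (auto simp: S_def midpoint_def convex_def scaleR_add_right)
        then have "d\<^sup>2 \<le> (dist z (midpoint y w))\<^sup>2" using d0 by (intro power_mono dle)
        moreover have "(dist z y)\<^sup>2 \<le> (d + inverse (real (Suc n)))\<^sup>2"
          "(dist z w)\<^sup>2 \<le> (d + inverse (real (Suc n)))\<^sup>2"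
          using yw by (auto simp: S_def intro!: power_mono)
        ultimately have "(dist y w)\<^sup>2 < e\<^sup>2"
          using n parallelogram_distance[of y w z] by linarith
        then show ?thesis using \<open>e > 0\<close> by (simp add: power_less_imp_less_base)
      qed
      then show ?thesis by blast
    qed
  qed blast
  then obtain p where p: "\<And>n. p \<in> S n" by blast
  have "dist z p \<le> d + 0"
  proof (rule LIMSEQ_le_const)
    show "(\<lambda>n. d + inverse (real (Suc n))) \<longlonglongrightarrow> d + 0"
      by (intro tendsto_intros LIMSEQ_inverse_real_of_nat)
    show "\<exists>N. \<forall>n\<ge>N. dist z p \<le> d + inverse (real (Suc n))"
      using p unfolding S_def by (metis IntD2 mem_cball)
  qed
  moreover have "p \<in> K" using p by (simp add: S_def)
  ultimately show ?thesis
    using dle that[of p] by (metis add_0_right order_trans)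
qed

text \<open>The description in \<open>metric_projection\<close> denotes a nearest point once
  existence (from completeness) and uniqueness (from convexity) are both known.\<close>

lemma metric_projection_nearest:
  fixes K :: "'a::{real_inner, complete_space} set"
  assumes "K \<noteq> {}" "closed K" "convex K"
  shows "metric_projection K z \<in> K"
    and "q \<in> K \<Longrightarrow> dist z (metric_projection K z) \<le> dist z q"
proof -
  obtain p where p: "p \<in> K" "\<And>q. q \<in> K \<Longrightarrow> dist z p \<le> dist z q"
    using nearest_point_exists[OF assms] by metis
  have "\<exists>!p. p \<in> K \<and> (\<forall>q\<in>K. dist z p \<le> dist z q)"
    using p any_closest_point_unique[OF assms(3,2)] by blast
  from theI'[OF this]
  show "metric_projection K z \<in> K"
    and "q \<in> K \<Longrightarrow> dist z (metric_projection K z) \<le> dist z q"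
    by (auto simp: metric_projection_def)
qed

text \<open>The vectors from the projection \<open>p\<close> to \<open>z\<close> and to
  \<open>y\<close> form no acute angle, so expanding the square of \<open>y - z\<close> around
  \<open>p\<close> adds only nonnegative terms to that of \<open>y - p\<close>.\<close>

lemma norm_metric_projection_le:
  fixes K :: "'a::{real_inner, complete_space} set"
  assumes "K \<noteq> {}" "closed K" "convex K" "y \<in> K"
  shows "norm (y - metric_projection K z) \<le> norm (y - z)"
proof -
  define p where "p = metric_projection K z"
  have "inner (z - p) (y - p) \<le> 0"
    using metric_projection_nearest[OF assms(1-3), where z = z] assms
    by (intro any_closest_point_dot[of K]) (auto simp: p_def)
  moreover have "(norm (y - z))\<^sup>2 = (norm (y - p))\<^sup>2 + (norm (z - p))\<^sup>2 - 2 * inner (z - p) (y - p)"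
    unfolding power2_norm_eq_inner by (simp add: inner_diff inner_commute)
  ultimately have "(norm (y - p))\<^sup>2 \<le> (norm (y - z))\<^sup>2"
    by (smt (verit) zero_le_power2)
  then show ?thesis unfolding p_def by (rule power2_le_imp_le) simp
qed

lemma perturbed_contraction_tendsto_0:
  fixes a b lam :: "nat \<Rightarrow> real"
  assumes nonneg: "\<And>k. a k \<ge> 0"
    and c: "c > 0"
    and lam_pos: "\<And>k. k \<ge> 1 \<Longrightarrow> lam k > 0"
    and lam_sum: "filterlim (\<lambda>n. \<Sum>k=1..n. lam k) at_top sequentially"
    and lam_0: "lam \<longlonglongrightarrow> 0"
    and b_0: "b \<longlonglongrightarrow> 0"
    and step: "\<And>k. k \<ge> 1 \<Longrightarrow> a (Suc k) \<le> (1 - c * lam k) * a k + lam k * b k"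
  shows "a \<longlonglongrightarrow> 0"
proof -
  have "\<forall>\<^sub>F k in sequentially. a k \<le> e" if e: "e > 0" for e
  proof -
    \<comment> \<open>The first bound keeps the perturbation below half of the contraction
      \<open>c * lam k * e\<close> available at level \<open>e\<close>; the second keeps the factor
      \<open>1 - c * lam k\<close> positive, so that it preserves inequalities.\<close>
    have "\<forall>\<^sub>F k in sequentially. b k < c * e / 2 \<and> lam k < 1 / c \<and> k \<ge> 1"
      using b_0 lam_0 c e
      by (intro eventually_conj order_tendstoD(2)[OF b_0] order_tendstoD(2)[OF lam_0]
            eventually_ge_at_top) auto
    then obtain N where N: "\<And>k. k \<ge> N \<Longrightarrow> b k < c * e / 2 \<and> lam k < 1 / c \<and> k \<ge> 1"
      by (auto simp: eventually_sequentially)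
    have lb: "lam k * b k \<le> lam k * (c * e / 2)" if "k \<ge> N" for k
      using N[OF that] lam_pos[of k] by (intro mult_left_mono) auto
    have stay: "a (Suc k) \<le> e" if "k \<ge> N" "a k \<le> e" for k
    proof -
      have "c * lam k \<le> 1" using N[OF that(1)] c by (simp add: field_simps)
      then have "(1 - c * lam k) * a k \<le> (1 - c * lam k) * e"
        using that by (intro mult_left_mono) auto
      moreover have "lam k * (c * e / 2) \<le> c * lam k * e"
        using lam_pos[of k] N[OF that(1)] c e by (simp add: field_simps)
      ultimately show ?thesis
        using step[of k] N[OF that(1)] lb[OF that(1)] by (simp add: algebra_simps)
    qed
    have "\<exists>m\<ge>N. a m \<le> e"
    proof (rule ccontr)
      assume "\<not> ?thesis"
      then have big: "a k > e" if "k \<ge> N" for k using that by force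
      have drop: "lam k * (c * e / 2) \<le> a k - a (Suc k)" if "k \<ge> N" for k
      proof -
        have "c * lam k * e \<le> c * lam k * a k"
          using big[OF that] c lam_pos[of k] N[OF that] by (intro mult_left_mono) auto
        then show ?thesis
          using step[of k] lb[OF that] N[OF that] by (simp add: algebra_simps)
      qed
      \<comment> \<open>Telescoping \<open>drop\<close> over the indices from \<open>Suc N\<close>
        to \<open>n\<close>; hence the end terms are \<open>a (Suc N)\<close> and
        \<open>a (Suc n)\<close>, and the case \<open>n = N\<close> is an equality.\<close>
      have bound: "(\<Sum>k=1..n. lam k) * (c * e / 2) \<le> (\<Sum>k=1..N. lam k) * (c * e / 2) + a (Suc N) - a (Suc n)"
        if "n \<ge> N" for n
        using that
      proof (induction n rule: dec_induct)
        case (step n)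
        then show ?case using drop[of "Suc n"] by (simp add: algebra_simps)
      qed simp
      \<comment> \<open>Once the partial sum exceeds \<open>B\<close>, \<open>bound\<close> would
        force \<open>a (Suc n)\<close> to be negative.\<close>
      define B where "B = ((\<Sum>k=1..N. lam k) * (c * e / 2) + a (Suc N)) / (c * e / 2)"
      have "\<forall>\<^sub>F n in sequentially. (\<Sum>k=1..n. lam k) > B \<and> n \<ge> N"
        using lam_sum by (intro eventually_conj eventually_ge_at_top) (simp add: filterlim_at_top_dense)
      then obtain n where n: "(\<Sum>k=1..n. lam k) > B" "n \<ge> N"
        using eventually_happens'[OF sequentially_bot] by blast
      have "(\<Sum>k=1..n. lam k) * (c * e / 2) > (\<Sum>k=1..N. lam k) * (c * e / 2) + a (Suc N)"
        using n(1) c e unfolding B_def by (subst (asm) pos_divide_less_eq) auto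
      with bound[OF n(2)] nonneg[of "Suc n"] show False by linarith
    qed
    then obtain m where m: "m \<ge> N" "a m \<le> e" by blast
    have "a k \<le> e" if "k \<ge> m" for k
      using that
    proof (induction k rule: dec_induct)
      case (step k)
      then show ?case using stay m(1) by simp
    qed (rule m(2))
    then show ?thesis by (auto simp: eventually_sequentially)
  qed
  note ev = this
  show ?thesis
  proof (rule order_tendstoI)
    show "\<forall>\<^sub>F k in sequentially. u < a k" if "u < 0" for u
      using less_le_trans[OF that nonneg] by simp
    show "\<forall>\<^sub>F k in sequentially. a k < u" if "0 < u" for u
      using ev[of "u / 2"] that by (auto elim: eventually_mono)
  qed
qed

theorem theorem4p5:
  fixes K :: "'a::{real_inner, complete_space} set"
    and F :: "'a \<Rightarrow> 'a"
    and \<gamma> :: real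
    and xs :: 'a
    and lam :: "nat \<Rightarrow> real"
    and x :: "nat \<Rightarrow> 'a"
  assumes "K \<noteq> {}" and "closed K" and "convex K"
    and "\<gamma> > 0"
    and "strongly_pseudomonotone_on K F \<gamma>"
    and "vi_solution K F xs"
    and "\<forall>k\<ge>1. lam k > 0"
    and "filterlim (\<lambda>n. \<Sum>k=1..n. lam k) at_top sequentially"
    and "lam \<longlonglongrightarrow> 0"
    and "x 1 \<in> K"
    and "\<forall>k\<ge>1. x (k + 1) = metric_projection K (x k - lam k *\<^sub>R F (x k))"
  shows "(\<forall>k\<ge>1. (norm (xs - x (k + 1)))\<^sup>2
            \<le> (1 - 2 * lam k * \<gamma>) * (norm (xs - x k))\<^sup>2 + (lam k)\<^sup>2 * (norm (F (x k)))\<^sup>2)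
         \<and> (bounded (F ` K) \<longrightarrow> x \<longlonglongrightarrow> xs)"
proof -
  have xsK: "xs \<in> K" using assms(6) by (simp add: vi_solution_def)
  have xK: "x k \<in> K" if "k \<ge> 1" for k
    using that
  proof (induction k rule: dec_induct)
    case (step k)
    then show ?case
      using assms(11) metric_projection_nearest(1)[OF assms(1-3)] by simp
  qed (rule assms(10))
  have i: "(norm (xs - x (k + 1)))\<^sup>2
      \<le> (1 - 2 * lam k * \<gamma>) * (norm (xs - x k))\<^sup>2 + (lam k)\<^sup>2 * (norm (F (x k)))\<^sup>2"
    if k: "k \<ge> 1" for k
  proof -
    have "inner (F xs) (x k - xs) \<ge> 0" using assms(6) xK[OF k] by (simp add: vi_solution_def)
    then have "inner (F (x k)) (x k - xs) \<ge> \<gamma> * (norm (x k - xs))\<^sup>2"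
      using assms(5) xK[OF k] xsK by (simp add: strongly_pseudomonotone_on_def)
    then have mono: "2 * lam k * (\<gamma> * (norm (xs - x k))\<^sup>2) \<le> 2 * lam k * inner (F (x k)) (x k - xs)"
      using assms(7) k by (intro mult_left_mono) (auto simp: norm_minus_commute less_imp_le)
    have "(norm (xs - x (k + 1)))\<^sup>2 \<le> (norm (xs - (x k - lam k *\<^sub>R F (x k))))\<^sup>2"
      using assms(11) k norm_metric_projection_le[OF assms(1-3) xsK] by (simp add: power_mono)
    also have "\<dots> = (norm (xs - x k))\<^sup>2 - 2 * lam k * inner (F (x k)) (x k - xs)
        + (lam k)\<^sup>2 * (norm (F (x k)))\<^sup>2"
      unfolding power2_norm_eq_inner
      by (simp add: inner_simps inner_commute power2_eq_square right_diff_distrib)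
    finally show ?thesis using mono by (simp add: algebra_simps)
  qed
  have ii: "x \<longlonglongrightarrow> xs" if bdd: "bounded (F ` K)"
  proof -
    obtain M where M: "\<And>y. y \<in> K \<Longrightarrow> norm (F y) \<le> M"
      using bdd by (auto simp: bounded_iff)
    \<comment> \<open>One of the two factors \<open>lam k\<close> in the error term of (i) is
      absorbed into \<open>b\<close>, so \<open>lam\<close> tending to 0 already makes
      \<open>b\<close> tend to 0.\<close>
    have "(\<lambda>k. (norm (xs - x k))\<^sup>2) \<longlonglongrightarrow> 0"
    proof (rule perturbed_contraction_tendsto_0[where lam = lam and c = "2 * \<gamma>" and b = "\<lambda>k. lam k * M\<^sup>2"])
      show "(\<lambda>k. lam k * M\<^sup>2) \<longlonglongrightarrow> 0"
        using tendsto_mult_left_zero[OF assms(9)] .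
      show "(norm (xs - x (Suc k)))\<^sup>2
          \<le> (1 - 2 * \<gamma> * lam k) * (norm (xs - x k))\<^sup>2 + lam k * (lam k * M\<^sup>2)" if k: "k \<ge> 1" for k
      proof -
        have "(lam k)\<^sup>2 * (norm (F (x k)))\<^sup>2 \<le> (lam k)\<^sup>2 * M\<^sup>2"
          using M[OF xK[OF k]] by (intro mult_left_mono power_mono) auto
        then show ?thesis
          using i[OF k] by (simp add: algebra_simps power2_eq_square)
      qed
    qed (use assms in auto)
    then have "(\<lambda>k. norm (x k - xs)) \<longlonglongrightarrow> 0"
      by (simp add: norm_minus_commute[of xs])
    then show ?thesis
      by (rule LIM_zero_cancel[OF tendsto_norm_zero_cancel])
  qed
  show ?thesis using i ii by blast
qed

end
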